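(* Let $G$ be a connected graph, and let $u$ and $v$ be adjacent vertices of $G$, each of degree at least $2$ in $G$. For integers $p \geq q \geq 1$ and $0 \leq \alpha < 1$, $$\rho_\alpha(G_{u,v}(p,q)) > \rho_\alpha(G_{u,v}(p+1,q-1)).$$
   Context: All graphs are finite, simple and undirected. For a graph $G$, $A(G)$ is its adjacency matrix and $D(G)$ the diagonal matrix of vertex degrees. For $\alpha\in[0,1]$, $A_\alpha(G) = \alpha D(G) + (1-\alpha)A(G)$, and $\rho_\alpha(G)$ is the largest eigenvalue of $A_\alpha(G)$. For a positive integer $p$ and $u\in V(G)$, $G(u;p)$ is the graph obtained from $G$ by attaching a pendant path of length $p$ at $u$ (i.e., adding new vertices $w_1,\dots,w_p$ and edges $uw_1, w_1w_2,\dots,w_{p-1}w_p$), and $G(u;0)=G$. For an edge $uv$ of $G$ and nonnegative integers $p,q$, $G_{u,v}(p,q)$ is the graph $H(v;q)$ where $H = G(u;p)$; i.e., a pendant path of length $p$ attached at $u$ and a vertex-disjoint pendant path of length $q$ attached at $v$. *)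

theory Defs
  imports
    "Graph_Theory.Digraph_Component"
    "Jordan_Normal_Form.Spectral_Radius"
begin

text \<open>
  A finite simple undirected graph is a \<^locale>\<open>pair_graph\<close>: a finite, symmetric, loop-free
  relation on a finite vertex set. Both orientations of an edge are arcs, so the degree of a vertex
  is its \<^const>\<open>out_degree\<close>.
\<close>

text \<open>
  Attaching at u a pendant path with vertices w_1, ..., w_p; the old vertices are tagged with
  \<^const>\<open>Inl\<close> and w_i is \<open>Inr i\<close>, which makes the new vertices fresh. For p = 0 the result
  is the tagged copy of G.
\<close>

definition attach_path :: "'a pair_pre_digraph \<Rightarrow> 'a \<Rightarrow> nat \<Rightarrow> ('a + nat) pair_pre_digraph" where
  "attach_path G u p =
    \<lparr> pverts = Inl ` pverts G \<union> Inr ` {1..p},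
      parcs = map_prod Inl Inl ` parcs G \<union>
        symcl ({(Inl u, Inr i) | i. i = 1 \<and> i \<le> p} \<union>
               {(Inr i, Inr (i + 1)) | i. 1 \<le> i \<and> i + 1 \<le> p}) \<rparr>"

definition attach_two_paths ::
    "'a pair_pre_digraph \<Rightarrow> 'a \<Rightarrow> 'a \<Rightarrow> nat \<Rightarrow> nat \<Rightarrow> (('a + nat) + nat) pair_pre_digraph" where
  "attach_two_paths G u v p q = attach_path (attach_path G u p) (Inl v) q"

text \<open>
  Matrices of a graph are taken with respect to a list \<open>vs\<close> enumerating its vertices. The
  spectrum does not depend on the enumeration, see \<open>spectrum_alpha_matrix_unique\<close> below.
\<close>

definition adjacency_matrix :: "'a pair_pre_digraph \<Rightarrow> 'a list \<Rightarrow> real mat" where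
  "adjacency_matrix G vs = Matrix.mat (length vs) (length vs)
     (\<lambda>(i, j). if (vs ! i, vs ! j) \<in> parcs G then 1 else 0)"

definition degree_matrix :: "'a pair_pre_digraph \<Rightarrow> 'a list \<Rightarrow> real mat" where
  "degree_matrix G vs = Matrix.mat (length vs) (length vs)
     (\<lambda>(i, j). if i = j then real (out_degree (with_proj G) (vs ! i)) else 0)"

definition alpha_matrix :: "real \<Rightarrow> 'a pair_pre_digraph \<Rightarrow> 'a list \<Rightarrow> real mat" where
  "alpha_matrix \<alpha> G vs =
     \<alpha> \<cdot>\<^sub>m degree_matrix G vs + (1 - \<alpha>) \<cdot>\<^sub>m adjacency_matrix G vs"

definition vertex_enum :: "'a pair_pre_digraph \<Rightarrow> 'a list" where
  "vertex_enum G = (SOME vs. distinct vs \<and> set vs = pverts G)"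

definition alpha_index :: "real \<Rightarrow> 'a pair_pre_digraph \<Rightarrow> real" where
  "alpha_index \<alpha> G = Max (spectrum (alpha_matrix \<alpha> G (vertex_enum G)))"

lemma vertex_enum:
  assumes "finite (pverts G)"
  shows "distinct (vertex_enum G)" "set (vertex_enum G) = pverts G"
proof -
  have "\<exists>vs. distinct vs \<and> set vs = pverts G"
    using finite_distinct_list[OF assms] by blast
  from someI_ex[OF this] show "distinct (vertex_enum G)" "set (vertex_enum G) = pverts G"
    unfolding vertex_enum_def by auto
qed

lemma alpha_matrix_mult_vec:
  assumes vs: "distinct vs" "set vs = pverts G" and i: "i < length vs"
    and x: "x \<in> carrier_vec (length vs)" and f: "\<And>j. j < length vs \<Longrightarrow> x $ j = f (vs ! j)"
  shows "(alpha_matrix \<alpha> G vs *\<^sub>v x) $ i =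
    \<alpha> * real (out_degree (with_proj G) (vs ! i)) * f (vs ! i) +
    (1 - \<alpha>) * (\<Sum>w | w \<in> pverts G \<and> (vs ! i, w) \<in> parcs G. f w)"
proof -
  let ?n = "length vs" and ?d = "real (out_degree (with_proj G) (vs ! i))"
  let ?a = "\<lambda>w. if (vs ! i, w) \<in> parcs G then f w else 0"
  have fin: "finite (pverts G)" using vs by (metis List.finite_set)
  have "(alpha_matrix \<alpha> G vs *\<^sub>v x) $ i =
      (\<Sum>j<?n. alpha_matrix \<alpha> G vs $$ (i, j) * x $ j)"
    using i x
    by (simp add: alpha_matrix_def adjacency_matrix_def degree_matrix_def scalar_prod_def
        lessThan_atLeast0)
  also have "\<dots> = (\<Sum>j<?n. (if i = j then \<alpha> * ?d * f (vs ! i) else 0) + (1 - \<alpha>) * ?a (vs ! j))"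
    using i f
    by (intro sum.cong)
      (auto simp: alpha_matrix_def adjacency_matrix_def degree_matrix_def algebra_simps)
  also have "\<dots> = \<alpha> * ?d * f (vs ! i) + (1 - \<alpha>) * (\<Sum>j<?n. ?a (vs ! j))"
    using i by (simp add: sum.distrib sum_distrib_left)
  also have "(\<Sum>j<?n. ?a (vs ! j)) = (\<Sum>w\<in>pverts G. ?a w)"
    by (rule sum.reindex_bij_betw) (use bij_betw_nth[OF vs(1), of "{..<?n}" "pverts G"] vs in simp)
  also have "\<dots> = (\<Sum>w | w \<in> pverts G \<and> (vs ! i, w) \<in> parcs G. f w)"
    using fin by (simp add: sum.inter_filter)
  finally show ?thesis .
qed

lemma spectrum_alpha_matrix_iff:
  assumes vs: "distinct vs" "set vs = pverts G"
  shows "k \<in> spectrum (alpha_matrix \<alpha> G vs) \<longleftrightarrow>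
    (\<exists>f. (\<exists>v\<in>pverts G. f v \<noteq> 0) \<and>
      (\<forall>v\<in>pverts G. \<alpha> * real (out_degree (with_proj G) v) * f v +
         (1 - \<alpha>) * (\<Sum>w | w \<in> pverts G \<and> (v, w) \<in> parcs G. f w) = k * f v))"
    (is "_ \<longleftrightarrow> (\<exists>f. ?P f)")
proof
  let ?n = "length vs" and ?M = "alpha_matrix \<alpha> G vs"
  have dim: "dim_row ?M = ?n"
    by (simp add: alpha_matrix_def adjacency_matrix_def degree_matrix_def)
  assume "k \<in> spectrum ?M"
  then obtain x where x: "x \<in> carrier_vec ?n" "x \<noteq> 0\<^sub>v ?n" "?M *\<^sub>v x = k \<cdot>\<^sub>v x"
    by (auto simp: spectrum_def eigenvalue_def eigenvector_def dim)
  define f where "f v = x $ (THE j. j < ?n \<and> vs ! j = v)" for v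
  have f: "x $ j = f (vs ! j)" if "j < ?n" for j
  proof -
    have "(THE j'. j' < ?n \<and> vs ! j' = vs ! j) = j"
      using that vs(1) by (intro the_equality) (auto simp: nth_eq_iff_index_eq)
    then show ?thesis by (simp add: f_def)
  qed
  have "\<exists>j<?n. x $ j \<noteq> 0" using x(1,2) by (auto simp: vec_eq_iff)
  then have "\<exists>v\<in>pverts G. f v \<noteq> 0" using f vs(2) by (metis nth_mem)
  moreover have "\<alpha> * real (out_degree (with_proj G) v) * f v +
         (1 - \<alpha>) * (\<Sum>w | w \<in> pverts G \<and> (v, w) \<in> parcs G. f w) = k * f v"
    if "v \<in> pverts G" for v
  proof -
    obtain i where i: "i < ?n" "vs ! i = v" using \<open>v \<in> pverts G\<close> vs(2) by (metis in_set_conv_nth)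
    show ?thesis
      using alpha_matrix_mult_vec[OF vs i(1) x(1) f, of \<alpha>] x(1,3) f[OF i(1)] i by simp
  qed
  ultimately show "\<exists>f. ?P f" by blast
next
  let ?n = "length vs" and ?M = "alpha_matrix \<alpha> G vs"
  have dim: "dim_row ?M = ?n"
    by (simp add: alpha_matrix_def adjacency_matrix_def degree_matrix_def)
  assume "\<exists>f. ?P f"
  then obtain f where f: "?P f" by blast
  let ?x = "Matrix.vec ?n (\<lambda>j. f (vs ! j))"
  have "?x \<noteq> 0\<^sub>v ?n"
  proof -
    from f obtain v where v: "v \<in> pverts G" "f v \<noteq> 0" by blast
    then obtain j where "j < ?n" "vs ! j = v" using vs(2) by (metis in_set_conv_nth)
    with v show ?thesis by (auto simp: vec_eq_iff)
  qed
  moreover have "?M *\<^sub>v ?x = k \<cdot>\<^sub>v ?x"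
  proof (rule eq_vecI)
    fix i assume "i < dim_vec (k \<cdot>\<^sub>v ?x)"
    then have i: "i < ?n" by simp
    then have "vs ! i \<in> pverts G" using vs(2) nth_mem by blast
    then show "(?M *\<^sub>v ?x) $ i = (k \<cdot>\<^sub>v ?x) $ i"
      using alpha_matrix_mult_vec[OF vs i, of ?x f \<alpha>] f i by simp
  qed (simp add: dim)
  ultimately show "k \<in> spectrum ?M"
    unfolding spectrum_def eigenvalue_def eigenvector_def dim mem_Collect_eq
    by (intro exI[of _ ?x] conjI vec_carrier)
qed

lemma spectrum_alpha_matrix_unique:
  assumes "distinct vs" "set vs = pverts G" "distinct ws" "set ws = pverts G"
  shows "spectrum (alpha_matrix \<alpha> G vs) = spectrum (alpha_matrix \<alpha> G ws)"
  using assms by (simp add: set_eq_iff spectrum_alpha_matrix_iff)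

lemma pair_graph_attach_path:
  assumes "pair_graph G" and u: "u \<in> pverts G"
  shows "pair_graph (attach_path G u p)"
proof -
  interpret pair_graph G by fact
  let ?R = "{(Inl u, Inr i) | i. i = 1 \<and> i \<le> p} \<union>
    {(Inr i, Inr (i + 1)) | i. 1 \<le> i \<and> i + 1 \<le> p} :: ('a + nat) rel"
  let ?V = "Inl ` pverts G \<union> Inr ` {1..p} :: ('a + nat) set"
  have "?R \<subseteq> ?V \<times> ?V" using u by auto
  moreover have "map_prod Inl Inl ` parcs G \<subseteq> ?V \<times> ?V"
    using in_arcsD1 in_arcsD2 by fastforce
  ultimately have sub: "parcs (attach_path G u p) \<subseteq> ?V \<times> ?V"
    by (fastforce simp: attach_path_def symcl_def)
  have fin: "finite ?V" using pair_finite_verts by simp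
  have "sym (parcs G)" using pair_sym_arcs by (simp add: symmetric_def)
  then have "sym (map_prod Inl Inl ` parcs G :: ('a + nat) rel)"
    unfolding sym_def by force
  then have "sym (parcs (attach_path G u p))"
    by (auto simp: attach_path_def symcl_def sym_def)
  then have sym: "symmetric (with_proj (attach_path G u p))" by (simp add: symmetric_def)
  have V: "pverts (attach_path G u p) = ?V" by (simp add: attach_path_def)
  show ?thesis
  proof
    fix e assume e: "e \<in> parcs (attach_path G u p)"
    show "fst e \<in> pverts (attach_path G u p)" "snd e \<in> pverts (attach_path G u p)"
      using e sub unfolding V by auto
    show "fst e \<noteq> snd e"
      using e pair_no_loops by (fastforce simp: attach_path_def symcl_def)
  next
    show "finite (pverts (attach_path G u p))" using fin V by simp
    show "finite (parcs (attach_path G u p))" using finite_subset[OF sub] fin by blast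
  qed (fact sym)
qed

end

theory Submission
  imports Defs "HOL-Analysis.Function_Topology"
begin

text \<open>
  A pendant path of length p at u can be eliminated from the eigenvalue equation for k: it only adds
  a potential to the diagonal entry of u, which depends on p and k through a linear recurrence S.
  Take k to be the index of the graph with paths p + 1 and q - 1 and f its Perron vector
  restricted to G. Passing to lengths p and q lowers the potential at u and raises it at v. Enlarging
  f at v by just the amount that restores the equation at u gives a vector whose defect at v is
  positive: this needs only f v / f u > S q / S (q + 1), the Casorati identity for S, and
  the monotonicity of S up to index p + 2. Hence k is strictly below the index of the other graph.
\<close>

text \<open>Both changes of potential have the Casorati constant K of S as numerator: the loss at u
  is (1 - \<alpha>) K / (S (p + 1) * S (p + 2)), the gain at v is (1 - \<alpha>) K / (S q * S (q +
  1)). Testing with f itself would need gain * (f v)^2 > loss * (f u)^2, which the bound on f v / f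
  u does not give, already for p = q. Enlarging f at v repairs the equation at u through the edge uv
  and leaves an inequality at v alone. The degree hypotheses act in two places. A second neighbour
  of v makes the neighbour sum at v exceed f u, and the equation at v turns this into the bound on f
  v / f u. A second neighbour of u is needed for monotonicity: for k < 2, which does occur on small
  trees with \<alpha> = 0, the recurrence is oscillatory and S need not grow by itself. There the
  equations at u, v and that neighbour force S (p + 2) \<le> S (p + 3), and concavity carries the
  growth back to smaller indices.\<close>

section \<open>Perron vectors of irreducible symmetric kernels\<close>

text \<open>Pinning functions to 0 outside \<open>V\<close> makes the box compact by Tychonoff, so
  that a quadratic form can be maximised over functions on vertices without choosing an
  enumeration.\<close>

lemma compact_fun_support:
  fixes V :: "'a set"
  shows "compact {f :: 'a \<Rightarrow> real. \<forall>a. f a \<in> (if a \<in> V then {- 1..1} else {0})}"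
proof -
  have "compactin (product_topology (\<lambda>_. euclidean) UNIV)
      (\<Pi>\<^sub>E a\<in>UNIV. (if a \<in> V then {- 1..1} else {0 :: real}))"
    by (subst compactin_PiE) auto
  then have "compact (\<Pi>\<^sub>E a\<in>UNIV. (if a \<in> V then {- 1..1} else {0 :: real}))"
    by (simp add: euclidean_product_topology)
  then show ?thesis by (simp add: PiE_def Pi_def)
qed

lemma rayleigh_maximiser_exists:
  fixes M :: "'a \<Rightarrow> 'a \<Rightarrow> real"
  assumes fin: "finite V" and ne: "V \<noteq> {}"
  obtains f where "(\<Sum>a\<in>V. (f a)\<^sup>2) = 1"
    and "\<And>g. (\<Sum>a\<in>V. (g a)\<^sup>2) = 1 \<Longrightarrow>
      (\<Sum>a\<in>V. \<Sum>b\<in>V. M a b * g a * g b) \<le> (\<Sum>a\<in>V. \<Sum>b\<in>V. M a b * f a * f b)"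
proof -
  define K where "K = {f :: 'a \<Rightarrow> real. \<forall>a. f a \<in> (if a \<in> V then {- 1..1} else {0})}"
  define N where "N f = (\<Sum>a\<in>V. (f a)\<^sup>2)" for f :: "'a \<Rightarrow> real"
  define Q where "Q f = (\<Sum>a\<in>V. \<Sum>b\<in>V. M a b * f a * f b)" for f
  have coord: "continuous_on UNIV (\<lambda>f :: 'a \<Rightarrow> real. f a)" for a
    by (rule continuous_on_product_coordinates)
  have cN: "continuous_on UNIV N" and cQ: "continuous_on UNIV Q"
    unfolding N_def Q_def by (intro continuous_intros coord)+
  have "closed (N -` {1})"
    using cN by (intro closed_vimage) auto
  then have comp: "compact (K \<inter> N -` {1})"
    using compact_fun_support[of V] unfolding K_def by blast
  \<comment> \<open>Cutting g off outside \<open>V\<close> changes neither \<open>N\<close> nor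
    \<open>Q\<close>, and a unit vector has its coordinates in [-1, 1]. So a maximum over the
    compact part of the sphere is a maximum over all unit vectors.\<close>
  have inK: "(\<lambda>a. if a \<in> V then g a else 0) \<in> K \<inter> N -` {1}" if "N g = 1" for g
  proof -
    have "\<bar>g a\<bar> \<le> 1" if "a \<in> V" for a
    proof -
      have "(g a)\<^sup>2 \<le> N g"
        unfolding N_def using fin that by (intro member_le_sum) auto
      then show ?thesis using \<open>N g = 1\<close> by (simp add: abs_square_le_1)
    qed
    then show ?thesis using that by (auto simp: K_def N_def abs_le_iff)
  qed
  obtain a0 where a0: "a0 \<in> V" using ne by blast
  have "N (\<lambda>a. if a = a0 then 1 else 0) = (\<Sum>a\<in>V. if a = a0 then 1 else 0)"
    unfolding N_def by (intro sum.cong) auto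
  then have "K \<inter> N -` {1} \<noteq> {}" using inK[of "\<lambda>a. if a = a0 then 1 else 0"] a0 fin by auto
  then obtain f where f: "f \<in> K \<inter> N -` {1}" "\<And>g. g \<in> K \<inter> N -` {1} \<Longrightarrow> Q g \<le> Q f"
    using continuous_attains_sup[OF comp, of Q] cQ continuous_on_subset by blast
  have "Q g \<le> Q f" if "N g = 1" for g
  proof -
    have "Q (\<lambda>a. if a \<in> V then g a else 0) = Q g" by (simp add: Q_def)
    then show ?thesis using f(2)[OF inK[OF that]] by simp
  qed
  then show ?thesis using that[of f] f(1) unfolding N_def Q_def by auto
qed

text \<open>The variational proof of Perron-Frobenius. As \<open>M\<close> is nonnegative, the
  absolute value of a Rayleigh maximiser is again a maximiser. It is an eigenvector by variation,
  and its zero set is closed under positive entries, so irreducibility excludes zeros.\<close>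

lemma perron_vector_exists:
  fixes M :: "'a \<Rightarrow> 'a \<Rightarrow> real"
  assumes fin: "finite V" and ne: "V \<noteq> {}"
    and sym: "\<And>a b. a \<in> V \<Longrightarrow> b \<in> V \<Longrightarrow> M a b = M b a"
    and nonneg: "\<And>a b. a \<in> V \<Longrightarrow> b \<in> V \<Longrightarrow> M a b \<ge> 0"
    and irred: "\<And>Z. Z \<subseteq> V \<Longrightarrow> Z \<noteq> {} \<Longrightarrow>
      (\<And>a b. a \<in> Z \<Longrightarrow> b \<in> V \<Longrightarrow> M a b > 0 \<Longrightarrow> b \<in> Z) \<Longrightarrow> Z = V"
  obtains k f where "\<And>a. a \<in> V \<Longrightarrow> f a > 0"
    and "\<And>a. a \<in> V \<Longrightarrow> (\<Sum>b\<in>V. M a b * f b) = k * f a"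
proof -
  define N where "N f = (\<Sum>a\<in>V. (f a)\<^sup>2)" for f :: "'a \<Rightarrow> real"
  define B where "B f g = (\<Sum>a\<in>V. \<Sum>b\<in>V. M a b * f a * g b)" for f g
  obtain f0 where f0: "N f0 = 1" "\<And>g. N g = 1 \<Longrightarrow> B g g \<le> B f0 f0"
    using rayleigh_maximiser_exists[OF fin ne, of M] unfolding N_def B_def by blast
  define f where "f a = \<bar>f0 a\<bar>" for a
  define k where "k = B f f"
  have Nf: "N f = 1" using f0(1) by (simp add: N_def f_def)
  have "B f0 f0 \<le> B f f"
    unfolding B_def
  proof (intro sum_mono)
    fix a b assume "a \<in> V" "b \<in> V"
    then show "M a b * f0 a * f0 b \<le> M a b * f a * f b"
      using nonneg[of a b] abs_ge_self[of "f0 a * f0 b"]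
      by (simp add: f_def abs_mult mult.assoc mult_left_mono)
  qed
  then have max1: "B g g \<le> k" if "N g = 1" for g
    using f0(2)[OF that] by (simp add: k_def)
  have scale: "B (\<lambda>a. r * g a) (\<lambda>a. r * g a) = r\<^sup>2 * B g g" for r g
    unfolding B_def by (simp add: sum_distrib_left power2_eq_square algebra_simps)
  have max: "B g g \<le> k * N g" for g
  proof (cases "N g = 0")
    case True
    then have "g a = 0" if "a \<in> V" for a
      using that fin by (simp add: N_def sum_nonneg_eq_0_iff)
    then have "B g g = 0" unfolding B_def by (simp)
    then show ?thesis using True by simp
  next
    case False
    moreover have "N g \<ge> 0" unfolding N_def by (intro sum_nonneg) auto
    ultimately have pos: "N g > 0" by simp
    define r where "r = 1 / sqrt (N g)"
    have r2: "r\<^sup>2 = 1 / N g" using pos by (simp add: r_def power_divide)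
    have "N (\<lambda>a. r * g a) = r\<^sup>2 * N g"
      by (simp add: N_def power_mult_distrib sum_distrib_left)
    then have "N (\<lambda>a. r * g a) = 1" using r2 pos by simp
    from max1[OF this] have "r\<^sup>2 * B g g \<le> k" by (simp add: scale)
    then show ?thesis using pos r2 by (simp add: field_simps)
  qed
  \<comment> \<open>The residual of the eigenvalue equation serves as the direction of variation:
    the linear term in e is then \<open>2 * e * N h\<close>, which maximality forbids unless h
    vanishes on \<open>V\<close>.\<close>
  define h where "h a = (\<Sum>b\<in>V. M a b * f b) - k * f a" for a
  have Bsym: "B g f = (\<Sum>a\<in>V. g a * (\<Sum>b\<in>V. M a b * f b))" for g
    unfolding B_def by (simp add: sum_distrib_left algebra_simps)
  have Bcomm: "B f g = B g f" for g
    unfolding B_def by (subst sum.swap) (auto intro!: sum.cong simp: sym algebra_simps)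
  have expand: "B (\<lambda>a. f a + e * h a) (\<lambda>a. f a + e * h a)
      = B f f + 2 * e * B h f + e\<^sup>2 * B h h" for e
  proof -
    have "B (\<lambda>a. f a + e * h a) (\<lambda>a. f a + e * h a)
      = B f f + e * B f h + e * B h f + e\<^sup>2 * B h h"
      unfolding B_def by (simp add: sum_distrib_left sum.distrib power2_eq_square algebra_simps)
    then show ?thesis using Bcomm[of h] by simp
  qed
  have expandN: "N (\<lambda>a. f a + e * h a) = N f + 2 * e * (\<Sum>a\<in>V. h a * f a) + e\<^sup>2 * N h" for e
    unfolding N_def
    by (simp add: sum_distrib_left sum.distrib power2_eq_square algebra_simps)
  have hh: "N h = B h f - k * (\<Sum>a\<in>V. h a * f a)"
  proof -
    have "(h a)\<^sup>2 = h a * (\<Sum>b\<in>V. M a b * f b) - k * (h a * f a)" for a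
      by (subst power2_eq_square, subst (2) h_def) (simp add: algebra_simps)
    then show ?thesis
      unfolding N_def Bsym by (simp only: sum_subtractf sum_distrib_left[of k])
  qed
  have quad: "2 * e * N h + e\<^sup>2 * (B h h - k * N h) \<le> 0" for e
    using max[of "\<lambda>a. f a + e * h a"] Nf unfolding expand expandN hh
    by (simp add: k_def algebra_simps)
  have Nh0: "N h \<ge> 0" unfolding N_def by (intro sum_nonneg) auto
  have "N h = 0"
  proof (rule ccontr)
    assume "N h \<noteq> 0"
    then have Nh: "N h > 0" using Nh0 by simp
    define D where "D = \<bar>B h h - k * N h\<bar> + 1"
    have D: "D > 0" "B h h - k * N h \<ge> - D" by (auto simp: D_def)
    \<comment> \<open>For this e the second-order term is at most \<open>e * N h\<close> in absolute
      value, half of the linear term.\<close>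
    define e where "e = N h / D"
    have e: "e > 0" using Nh D by (simp add: e_def)
    have "e\<^sup>2 * (- D) \<le> e\<^sup>2 * (B h h - k * N h)" using D by (intro mult_left_mono) auto
    then have "2 * e * N h - e\<^sup>2 * D \<le> 0" using quad[of e] by simp
    moreover have "e\<^sup>2 * D = e * N h" using D by (simp add: e_def power2_eq_square)
    ultimately have "e * N h \<le> 0" by simp
    then show False using e Nh by (simp add: mult_le_0_iff)
  qed
  then have h0: "h a = 0" if "a \<in> V" for a
    using that fin by (simp add: N_def sum_nonneg_eq_0_iff)
  then have eig: "(\<Sum>b\<in>V. M a b * f b) = k * f a" if "a \<in> V" for a
    using that by (simp add: h_def)
  have f_nonneg: "f a \<ge> 0" for a by (simp add: f_def)
  have "f a > 0" if "a \<in> V" for a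
  proof (rule ccontr)
    assume "\<not> f a > 0"
    define Z where "Z = {a \<in> V. f a = 0}"
    have "Z = V"
    proof (rule irred)
      show "Z \<noteq> {}" using \<open>\<not> f a > 0\<close> that f_nonneg[of a] by (auto simp: Z_def)
      show "b \<in> Z" if ab: "a \<in> Z" "b \<in> V" "M a b > 0" for a b
      proof -
        have "(\<Sum>b\<in>V. M a b * f b) = 0" using eig ab(1) by (simp add: Z_def)
        then have "M a b * f b = 0"
          using ab fin nonneg f_nonneg by (subst (asm) sum_nonneg_eq_0_iff) (auto simp: Z_def)
        then show ?thesis using ab by (simp add: Z_def)
      qed
    qed (auto simp: Z_def)
    then have "N f = 0" by (auto simp: N_def Z_def intro!: sum.neutral)
    then show False using Nf by simp
  qed
  then show ?thesis using that eig by blast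
qed

section \<open>The operator of the alpha matrix\<close>

text \<open>The degree is split into one \<open>\<alpha> * f a\<close> per neighbour, so that
  attaching an edge adds a single summand.\<close>

definition alpha_op :: "real \<Rightarrow> 'a pair_pre_digraph \<Rightarrow> ('a \<Rightarrow> real) \<Rightarrow> 'a \<Rightarrow> real" where
  "alpha_op \<alpha> G f a = (\<Sum>b | (a, b) \<in> parcs G. \<alpha> * f a + (1 - \<alpha>) * f b)"

lemma pair_graph_finite_nbrs:
  assumes "pair_graph G"
  shows "finite {b. (a, b) \<in> parcs G}"
proof -
  interpret pair_graph G by fact
  have "{b. (a, b) \<in> parcs G} \<subseteq> pverts G" using in_arcsD2 by auto
  then show ?thesis using pair_finite_verts finite_subset by blast
qed

lemma out_degree_eq_card_nbrs:
  "out_degree (with_proj G) a = card {b. (a, b) \<in> parcs G}"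
proof -
  have "out_arcs (with_proj G) a = Pair a ` {b. (a, b) \<in> parcs G}"
    by (auto simp: out_arcs_def)
  then show ?thesis unfolding out_degree_def by (simp add: card_image inj_on_def)
qed

lemma alpha_op_eq_degree:
  "alpha_op \<alpha> G f a = \<alpha> * real (out_degree (with_proj G) a) * f a +
    (1 - \<alpha>) * (\<Sum>b | (a, b) \<in> parcs G. f b)"
  by (simp add: alpha_op_def out_degree_eq_card_nbrs sum.distrib sum_distrib_left)

lemma pair_graph_nbrs_in_verts:
  assumes "pair_graph G"
  shows "{b. b \<in> pverts G \<and> (a, b) \<in> parcs G} = {b. (a, b) \<in> parcs G}"
proof -
  interpret pair_graph G by fact
  show ?thesis using in_arcsD2 by auto
qed

lemma spectrum_alpha_matrix_vertex_enum_iff: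
  assumes "pair_graph G"
  shows "k \<in> spectrum (alpha_matrix \<alpha> G (vertex_enum G)) \<longleftrightarrow>
    (\<exists>f. (\<exists>a\<in>pverts G. f a \<noteq> 0) \<and> (\<forall>a\<in>pverts G. alpha_op \<alpha> G f a = k * f a))"
proof -
  interpret pair_graph G by fact
  show ?thesis
    by (simp add: spectrum_alpha_matrix_iff[OF vertex_enum[OF pair_finite_verts]]
        alpha_op_eq_degree pair_graph_nbrs_in_verts[OF assms])
qed

lemma alpha_op_eq_kernel:
  assumes "pair_graph G" and a: "a \<in> pverts G"
  shows "alpha_op \<alpha> G f a = (\<Sum>b\<in>pverts G.
    ((if a = b then \<alpha> * real (out_degree (with_proj G) a) else 0) +
     (if (a, b) \<in> parcs G then 1 - \<alpha> else 0)) * f b)"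
proof -
  interpret pair_graph G by fact
  have "(\<Sum>b\<in>pverts G. (if (a, b) \<in> parcs G then 1 - \<alpha> else 0) * f b)
      = (\<Sum>b\<in>pverts G. if (a, b) \<in> parcs G then (1 - \<alpha>) * f b else 0)"
    by (intro sum.cong) auto
  also have "\<dots> = (1 - \<alpha>) * (\<Sum>b | (a, b) \<in> parcs G. f b)"
    using pair_finite_verts
    by (simp add: sum.inter_filter[symmetric] pair_graph_nbrs_in_verts[OF assms(1)] sum_distrib_left)
  finally have *: "(\<Sum>b\<in>pverts G. (if (a, b) \<in> parcs G then 1 - \<alpha> else 0) * f b)
      = (1 - \<alpha>) * (\<Sum>b | (a, b) \<in> parcs G. f b)" .
  have "(\<Sum>b\<in>pverts G. (if a = b then \<alpha> * real (out_degree (with_proj G) a) else 0) * f b)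
      = (\<Sum>b\<in>pverts G. if a = b then \<alpha> * real (out_degree (with_proj G) a) * f b else 0)"
    by (intro sum.cong) auto
  also have "\<dots> = \<alpha> * real (out_degree (with_proj G) a) * f a"
    using pair_finite_verts a by simp
  finally show ?thesis
    using * by (simp add: alpha_op_eq_degree distrib_right sum.distrib)
qed

lemma alpha_op_self_adjoint:
  assumes "pair_graph G"
  shows "(\<Sum>a\<in>pverts G. g a * alpha_op \<alpha> G f a) = (\<Sum>a\<in>pverts G. f a * alpha_op \<alpha> G g a)"
proof -
  interpret pair_graph G by fact
  have "(a, b) \<in> parcs G \<longleftrightarrow> (b, a) \<in> parcs G" for a b
    using pair_sym_arcs by (auto simp: symmetric_def sym_def)
  then show ?thesis
    by (simp add: alpha_op_eq_kernel[OF assms] sum_distrib_left)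
      (subst sum.swap, auto intro!: sum.cong)
qed

text \<open>Connectedness in the form in which the Perron argument uses it, as irreducibility. Arcs
  come in both orientations, so connected means strongly connected, and the set reachable from a
  vertex is closed.\<close>

lemma connected_iff_no_closed_subset:
  assumes "pair_graph G"
  shows "Digraph_Component.connected (with_proj G) \<longleftrightarrow> pverts G \<noteq> {} \<and>
    (\<forall>Z. Z \<subseteq> pverts G \<longrightarrow> Z \<noteq> {} \<longrightarrow> (\<forall>a b. a \<in> Z \<longrightarrow> (a, b) \<in> parcs G \<longrightarrow> b \<in> Z) \<longrightarrow> Z = pverts G)"
proof -
  interpret pair_graph G by fact
  have sc: "Digraph_Component.connected (with_proj G) \<longleftrightarrow> strongly_connected (with_proj G)"
    by (simp add: connected_def strongly_connected_def reachable_mk_symmetric_eq[OF pair_sym_arcs])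
  show ?thesis
  proof (intro iffI conjI allI impI)
    assume "Digraph_Component.connected (with_proj G)"
    then have s: "strongly_connected (with_proj G)" using sc by simp
    then show "pverts G \<noteq> {}" by (simp add: strongly_connected_def)
    fix Z assume Z: "Z \<subseteq> pverts G" "Z \<noteq> {}" "\<forall>a b. a \<in> Z \<longrightarrow> (a, b) \<in> parcs G \<longrightarrow> b \<in> Z"
    then obtain a where a: "a \<in> Z" by blast
    have "b \<in> Z" if "b \<in> pverts G" for b
    proof -
      have "a \<rightarrow>\<^sup>*\<^bsub>with_proj G\<^esub> b" using s a Z(1) that by (auto simp: strongly_connected_def)
      then show ?thesis
        by (induction rule: reachable_induct) (use a Z(3) in auto)
    qed
    then show "Z = pverts G" using Z(1) by blast
  next
    assume *: "pverts G \<noteq> {} \<and> (\<forall>Z. Z \<subseteq> pverts G \<longrightarrow> Z \<noteq> {} \<longrightarrow>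
      (\<forall>a b. a \<in> Z \<longrightarrow> (a, b) \<in> parcs G \<longrightarrow> b \<in> Z) \<longrightarrow> Z = pverts G)"
    have "strongly_connected (with_proj G)"
      unfolding strongly_connected_def
    proof (intro conjI ballI)
      show "verts (with_proj G) \<noteq> {}" using * by simp
      fix a b assume ab: "a \<in> verts (with_proj G)" "b \<in> verts (with_proj G)"
      define Z where "Z = {b. a \<rightarrow>\<^sup>*\<^bsub>with_proj G\<^esub> b}"
      have "Z \<subseteq> pverts G" unfolding Z_def using reachable_in_verts(2) by fastforce
      moreover have "a \<in> Z" using ab by (simp add: Z_def)
      moreover have "c \<in> Z" if "b \<in> Z" "(b, c) \<in> parcs G" for b c
        using that unfolding Z_def by (auto intro: reachable_adj_trans)
      ultimately have "Z = pverts G" using * by blast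
      then show "a \<rightarrow>\<^sup>*\<^bsub>with_proj G\<^esub> b" using ab by (auto simp: Z_def)
    qed
    then show "Digraph_Component.connected (with_proj G)" using sc by simp
  qed
qed

section \<open>The index as Perron eigenvalue, and strict lower bounds for it\<close>

lemma alpha_op_mono:
  assumes "0 \<le> \<alpha>" "\<alpha> \<le> 1" and "f a \<le> g a" and "\<And>b. (a, b) \<in> parcs G \<Longrightarrow> f b \<le> g b"
  shows "alpha_op \<alpha> G f a \<le> alpha_op \<alpha> G g a"
  unfolding alpha_op_def using assms by (intro sum_mono add_mono mult_left_mono) auto

text \<open>The Perron eigenvalue k has to be identified with the maximum of the spectrum. For any
  eigenpair (k', g), the absolute value h of g satisfies
  \<open>k' * h a \<le> alpha_op \<alpha> G h a\<close>; pairing with the positive f and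
  self-adjointness give k' \<le> k.\<close>

lemma alpha_index_perron_vector:
  assumes G: "pair_graph G" "Digraph_Component.connected (with_proj G)"
    and \<alpha>: "0 \<le> \<alpha>" "\<alpha> < 1"
  obtains f where "\<And>a. a \<in> pverts G \<Longrightarrow> f a > 0"
    and "\<And>a. a \<in> pverts G \<Longrightarrow> alpha_op \<alpha> G f a = alpha_index \<alpha> G * f a"
proof -
  interpret pair_graph G by (fact G(1))
  let ?V = "pverts G" and ?sp = "spectrum (alpha_matrix \<alpha> G (vertex_enum G))"
  let ?M = "\<lambda>a b. (if a = b then \<alpha> * real (out_degree (with_proj G) a) else 0) +
     (if (a, b) \<in> parcs G then 1 - \<alpha> else 0)"
  have sym: "(a, b) \<in> parcs G \<longleftrightarrow> (b, a) \<in> parcs G" for a b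
    using pair_sym_arcs by (auto simp: symmetric_def sym_def)
  note conn = G(2)[unfolded connected_iff_no_closed_subset[OF G(1)]]
  obtain k f where f: "\<And>a. a \<in> ?V \<Longrightarrow> f a > 0"
    and eig: "\<And>a. a \<in> ?V \<Longrightarrow> (\<Sum>b\<in>?V. ?M a b * f b) = k * f a"
  proof (rule perron_vector_exists[of ?V ?M])
    show "finite ?V" by (rule pair_finite_verts)
    show "?V \<noteq> {}" using conn by blast
    show "?M a b = ?M b a" for a b using sym[of a b] by simp
    show "?M a b \<ge> 0" for a b using \<alpha> by simp
    fix Z assume Z: "Z \<subseteq> ?V" "Z \<noteq> {}" "\<And>a b. a \<in> Z \<Longrightarrow> b \<in> ?V \<Longrightarrow> ?M a b > 0 \<Longrightarrow> b \<in> Z"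
    have "b \<in> Z" if "a \<in> Z" "(a, b) \<in> parcs G" for a b
    proof -
      have "b \<in> ?V" using that in_arcsD2 by blast
      moreover have "?M a b > 0" using that \<alpha> by (simp add: add_nonneg_pos)
      ultimately show ?thesis using Z(3) that by blast
    qed
    then show "Z = ?V" using conn Z(1,2) by blast
  qed blast
  have eig: "alpha_op \<alpha> G f a = k * f a" if "a \<in> ?V" for a
    using eig[OF that] alpha_op_eq_kernel[OF G(1) that] by simp
  obtain a0 where "a0 \<in> ?V" using conn by blast
  then have "\<exists>a\<in>?V. f a \<noteq> 0" using f by (metis less_irrefl)
  then have "k \<in> ?sp"
    using eig unfolding spectrum_alpha_matrix_vertex_enum_iff[OF G(1)] by blast
  moreover have "finite ?sp"
    by (rule card_finite_spectrum(1)[of _ "length (vertex_enum G)"])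
      (simp add: alpha_matrix_def degree_matrix_def adjacency_matrix_def)
  moreover have "k' \<le> k" if "k' \<in> ?sp" for k'
  proof -
    from that[unfolded spectrum_alpha_matrix_vertex_enum_iff[OF G(1)]]
    obtain g where g: "\<exists>a\<in>?V. g a \<noteq> 0" "\<forall>a\<in>?V. alpha_op \<alpha> G g a = k' * g a"
      by (elim exE conjE)
    define h where "h a = \<bar>g a\<bar>" for a
    have sub: "k' * h a \<le> alpha_op \<alpha> G h a" if "a \<in> ?V" for a
    proof -
      have "k' * h a \<le> \<bar>alpha_op \<alpha> G g a\<bar>"
        using g(2) that by (simp add: h_def abs_mult mult_right_mono)
      also have "\<dots> \<le> (\<Sum>b | (a, b) \<in> parcs G. \<bar>\<alpha> * g a + (1 - \<alpha>) * g b\<bar>)"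
        unfolding alpha_op_def by (rule sum_abs)
      also have "\<dots> \<le> alpha_op \<alpha> G h a"
        unfolding alpha_op_def h_def
        using \<alpha> by (intro sum_mono order.trans[OF abs_triangle_ineq]) (simp add: abs_mult)
      finally show ?thesis .
    qed
    have "(\<Sum>a\<in>?V. f a * (k' * h a)) \<le> (\<Sum>a\<in>?V. f a * alpha_op \<alpha> G h a)"
      using sub f by (intro sum_mono mult_left_mono) (auto simp: less_imp_le)
    also have "\<dots> = (\<Sum>a\<in>?V. h a * (k * f a))"
      unfolding alpha_op_self_adjoint[OF G(1), of f] using eig by simp
    finally have "k' * (\<Sum>a\<in>?V. f a * h a) \<le> k * (\<Sum>a\<in>?V. f a * h a)"
      by (simp add: sum_distrib_left algebra_simps)
    moreover have "(\<Sum>a\<in>?V. f a * h a) > 0"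
    proof -
      obtain a where "a \<in> ?V" "g a \<noteq> 0" using g(1) by blast
      then show ?thesis
        using f pair_finite_verts by (intro sum_pos2[of _ a]) (auto simp: h_def less_imp_le)
    qed
    ultimately show ?thesis by simp
  qed
  ultimately have "alpha_index \<alpha> G = k" unfolding alpha_index_def by (intro Max_eqI) auto
  then show ?thesis using that f eig by blast
qed

text \<open>Paired with the Perron vector, the two sides become k and the index times the same sum.
  That vector is positive everywhere, so strictness at one vertex survives the summation.\<close>

lemma alpha_index_gt_of_subsolution:
  assumes G: "pair_graph G" "Digraph_Component.connected (with_proj G)"
    and \<alpha>: "0 \<le> \<alpha>" "\<alpha> < 1"
    and z: "\<And>a. a \<in> pverts G \<Longrightarrow> z a > 0"
    and sub: "\<And>a. a \<in> pverts G \<Longrightarrow> k * z a \<le> alpha_op \<alpha> G z a"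
    and strict: "a0 \<in> pverts G" "k * z a0 < alpha_op \<alpha> G z a0"
  shows "k < alpha_index \<alpha> G"
proof -
  interpret pair_graph G by (fact G(1))
  let ?V = "pverts G"
  obtain f where f: "\<And>a. a \<in> ?V \<Longrightarrow> f a > 0"
    and eig: "\<And>a. a \<in> ?V \<Longrightarrow> alpha_op \<alpha> G f a = alpha_index \<alpha> G * f a"
    using alpha_index_perron_vector[OF G \<alpha>] by blast
  have "(\<Sum>a\<in>?V. f a * (k * z a)) < (\<Sum>a\<in>?V. f a * alpha_op \<alpha> G z a)"
  proof (rule sum_strict_mono_ex1)
    show "finite ?V" by (rule pair_finite_verts)
    show "\<forall>a\<in>?V. f a * (k * z a) \<le> f a * alpha_op \<alpha> G z a"
      using f sub by (simp add: less_imp_le)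
    show "\<exists>a\<in>?V. f a * (k * z a) < f a * alpha_op \<alpha> G z a"
      using f strict by (intro bexI[of _ a0]) auto
  qed
  also have "\<dots> = (\<Sum>a\<in>?V. z a * (alpha_index \<alpha> G * f a))"
    unfolding alpha_op_self_adjoint[OF G(1), of f] using eig by simp
  finally have "k * (\<Sum>a\<in>?V. f a * z a) < alpha_index \<alpha> G * (\<Sum>a\<in>?V. f a * z a)"
    by (simp add: sum_distrib_left algebra_simps)
  moreover have "(\<Sum>a\<in>?V. f a * z a) \<ge> 0" using f z by (intro sum_nonneg) (simp add: less_imp_le)
  ultimately show ?thesis by (simp add: mult_less_cancel_right)
qed

section \<open>Eigenvector values along a pendant path\<close>

text \<open>
  The n-th value counted from the free end of a pendant path. The value \<open>- c\<close> at the
  virtual index 0 makes the equation at the end vertex, which has degree 1, an instance of the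
  recurrence, and makes the potential of the empty path vanish.
\<close>

fun path_seq :: "real \<Rightarrow> real \<Rightarrow> nat \<Rightarrow> real" where
  "path_seq c t 0 = - c"
| "path_seq c t (Suc 0) = 1"
| "path_seq c t (Suc (Suc n)) = t * path_seq c t (Suc n) - path_seq c t n"

text \<open>The Casorati determinant is constant because the recurrence has coefficient -1 at the
  older term; its value is read off at n = 0.\<close>

lemma path_seq_casorati:
  "(path_seq c t (Suc n))\<^sup>2 - path_seq c t n * path_seq c t (Suc (Suc n)) = 1 + c * (t + c)"
proof (induction n)
  case (Suc n)
  then show ?case by (simp add: power2_eq_square algebra_simps)
qed (simp add: algebra_simps)

text \<open>On positive terms the sequence is convex for t \<ge> 2 and concave for t < 2. In the
  convex case growth propagates upwards from the first step, from 1 to t + c. In the concave case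
  the last difference is the smallest, so growth there is inherited downwards.\<close>

lemma path_seq_mono:
  assumes c: "c \<ge> 0" and pos: "\<And>j. j \<le> m \<Longrightarrow> path_seq c t (Suc j) > 0"
    and grow: "t \<ge> 2 \<or> path_seq c t (Suc m) \<le> path_seq c t (Suc (Suc m))"
    and n: "n < m"
  shows "path_seq c t (Suc n) \<le> path_seq c t (Suc (Suc n))"
proof (cases "t \<ge> 2")
  case True
  show ?thesis
    using n
  proof (induction n)
    case 0
    then show ?case using True c by simp
  next
    case (Suc n)
    have "2 * path_seq c t (Suc (Suc n)) \<le> t * path_seq c t (Suc (Suc n))"
      using True pos[of "Suc n"] Suc.prems by (intro mult_right_mono) auto
    then show ?case using Suc by simp
  qed
next
  case False
  have "path_seq c t (Suc n) \<le> path_seq c t (Suc (Suc n))" if "n \<le> m" for n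
    using that
  proof (induction rule: inc_induct)
    case base
    then show ?case using False grow by simp
  next
    case (step n)
    have "t * path_seq c t (Suc (Suc n)) \<le> 2 * path_seq c t (Suc (Suc n))"
      using False pos[of "Suc n"] step.hyps by (intro mult_right_mono) auto
    then show ?case using step.IH by simp
  qed
  then show ?thesis using n by simp
qed

text \<open>Solving the eigenvalue equation at an inner path vertex, of degree 2, for the next value
  gives this t.\<close>

definition alpha_path_seq :: "real \<Rightarrow> real \<Rightarrow> nat \<Rightarrow> real" where
  "alpha_path_seq \<alpha> k = path_seq (\<alpha> / (1 - \<alpha>)) ((k - 2 * \<alpha>) / (1 - \<alpha>))"

text \<open>What the edge into the path contributes to the equation at u, per unit of the value at
  u: the quotient is the ratio of the first path value to the value at u.\<close>

definition path_weight :: "real \<Rightarrow> real \<Rightarrow> nat \<Rightarrow> real" where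
  "path_weight \<alpha> k p = \<alpha> + (1 - \<alpha>) * alpha_path_seq \<alpha> k p / alpha_path_seq \<alpha> k (Suc p)"

lemma alpha_path_seq_recurrence:
  assumes "\<alpha> < 1"
  shows "\<alpha> * alpha_path_seq \<alpha> k (Suc 0) + (1 - \<alpha>) * alpha_path_seq \<alpha> k 0 = 0"
    and "alpha_path_seq \<alpha> k (Suc 0) = 1"
    and "2 * \<alpha> * alpha_path_seq \<alpha> k (Suc n) +
      (1 - \<alpha>) * (alpha_path_seq \<alpha> k n + alpha_path_seq \<alpha> k (Suc (Suc n))) =
      k * alpha_path_seq \<alpha> k (Suc n)"
  using assms by (simp_all add: alpha_path_seq_def field_simps)

text \<open>Read as a formula for \<open>k - path_weight \<alpha> k n\<close>, this is what the
  other edges at the attachment vertex must contribute: as much as a single edge prolonging the path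
  beyond that vertex.\<close>

lemma path_weight_eq_succ:
  assumes "\<alpha> < 1" and "alpha_path_seq \<alpha> k (Suc n) > 0"
  shows "path_weight \<alpha> k n =
    k - \<alpha> - (1 - \<alpha>) * alpha_path_seq \<alpha> k (Suc (Suc n)) / alpha_path_seq \<alpha> k (Suc n)"
proof -
  let ?S = "alpha_path_seq \<alpha> k"
  have "(1 - \<alpha>) * ?S n = (k - 2 * \<alpha>) * ?S (Suc n) - (1 - \<alpha>) * ?S (Suc (Suc n))"
    using alpha_path_seq_recurrence(3)[OF assms(1), of k n] by (simp add: algebra_simps)
  then show ?thesis using assms(2) by (simp add: path_weight_def field_simps)
qed

text \<open>The numerator is the constant of \<open>path_seq_casorati\<close>, so the effect of one
  more vertex depends on n only through the denominator.\<close>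

lemma path_weight_diff:
  assumes "alpha_path_seq \<alpha> k (Suc n) > 0" "alpha_path_seq \<alpha> k (Suc (Suc n)) > 0"
  shows "path_weight \<alpha> k (Suc n) - path_weight \<alpha> k n =
    (1 - \<alpha>) * ((alpha_path_seq \<alpha> k (Suc n))\<^sup>2 - alpha_path_seq \<alpha> k n * alpha_path_seq \<alpha> k (Suc (Suc n))) /
      (alpha_path_seq \<alpha> k (Suc n) * alpha_path_seq \<alpha> k (Suc (Suc n)))"
  using assms by (simp add: path_weight_def field_simps power2_eq_square)

section \<open>The shifted test vector\<close>

lemma sum_ge_two_terms:
  fixes f :: "'a \<Rightarrow> real"
  assumes "finite A" "a \<in> A" "b \<in> A" "a \<noteq> b" and "\<And>x. x \<in> A \<Longrightarrow> f x \<ge> 0"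
  shows "f a + f b \<le> sum f A"
proof -
  have "sum f {a, b} \<le> sum f A" using assms by (intro sum_mono2) auto
  then show ?thesis using assms by simp
qed

text \<open>With the paths encoded in the two weights, this concerns \<open>G\<close> alone. Adding
  b at v keeps equality at u and can only help the other neighbours of v; the work lies in the sign
  of the defect at v.\<close>

lemma shifted_subsolution:
  fixes G :: "'a pair_pre_digraph" and f :: "'a \<Rightarrow> real"
  assumes G: "pair_graph G" and uv: "(u, v) \<in> parcs G"
    and du: "out_degree (with_proj G) u \<ge> 2" and dv: "out_degree (with_proj G) v \<ge> 2"
    and pq: "q \<le> p" "1 \<le> q" and \<alpha>: "0 \<le> \<alpha>" "\<alpha> < 1"
    and S: "\<And>j. j \<le> Suc p \<Longrightarrow> alpha_path_seq \<alpha> k (Suc j) > 0"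
    and f: "\<And>a. a \<in> pverts G \<Longrightarrow> f a > 0"
    and eig: "\<And>a. a \<in> pverts G \<Longrightarrow> alpha_op \<alpha> G f a +
      (if a = u then path_weight \<alpha> k (Suc p) * f a else 0) +
      (if a = v then path_weight \<alpha> k (q - 1) * f a else 0) = k * f a"
  obtains z where "\<And>a. a \<in> pverts G \<Longrightarrow> z a > 0"
    and "\<And>a. a \<in> pverts G \<Longrightarrow> k * z a \<le> alpha_op \<alpha> G z a +
      (if a = u then path_weight \<alpha> k p * z a else 0) +
      (if a = v then path_weight \<alpha> k q * z a else 0)"
    and "k * z v < alpha_op \<alpha> G z v + path_weight \<alpha> k q * z v"
proof -
  interpret pair_graph G by fact
  define S where "S = alpha_path_seq \<alpha> k"
  define \<beta> where "\<beta> = 1 - \<alpha>"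
  define c where "c = \<alpha> / \<beta>"
  define t where "t = (k - 2 * \<alpha>) / \<beta>"
  define K where "K = 1 + c * (t + c)"
  have \<beta>: "\<beta> > 0" using \<alpha> by (simp add: \<beta>_def)
  have c: "c \<ge> 0" "\<alpha> = \<beta> * c" using \<alpha> \<beta> by (auto simp: c_def)
  have k: "k = \<beta> * (t + 2 * c)" using \<beta> by (simp add: t_def c_def field_simps)
  have S_seq: "S = path_seq c t" by (simp add: S_def c_def t_def \<beta>_def alpha_path_seq_def)
  have S_pos: "S (Suc j) > 0" if "j \<le> Suc p" for j using S[OF that] by (simp add: S_def)
  have S_cas: "(S (Suc n))\<^sup>2 - S n * S (Suc (Suc n)) = K" for n
    unfolding S_seq K_def by (rule path_seq_casorati)
  have "t + c > 0" using S_pos[of 1] by (simp add: S_seq)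
  then have K: "K > 0" using c by (simp add: K_def add_pos_nonneg)
  obtain q' where q: "q = Suc q'" using pq by (cases q) auto
  define x y where "x = f u" and "y = f v"
  have verts: "u \<in> pverts G" "v \<in> pverts G" using uv in_arcsD1 in_arcsD2 by auto
  have neq: "u \<noteq> v" using uv pair_no_loops by fastforce
  have vu: "(v, u) \<in> parcs G" using uv pair_sym_arcs by (auto simp: symmetric_def sym_def)
  have no_loop: "(a, a) \<notin> parcs G" for a using pair_no_loops by fastforce
  have fin: "finite {b. (a, b) \<in> parcs G}" for a by (rule pair_graph_finite_nbrs[OF G])
  have nb_pos: "f b > 0" if "(a, b) \<in> parcs G" for a b using that f in_arcsD2 by blast
  have other: "\<exists>w. (a, w) \<in> parcs G \<and> w \<noteq> b" if "out_degree (with_proj G) a \<ge> 2" for a b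
  proof (rule ccontr)
    assume "\<not> ?thesis"
    then have "{w. (a, w) \<in> parcs G} \<subseteq> {b}" by blast
    from card_mono[OF _ this] that show False by (simp add: out_degree_eq_card_nbrs)
  qed
  have xy: "x > 0" "y > 0" using f verts by (auto simp: x_def y_def)
  define d T where "d = real (out_degree (with_proj G) v)" and "T = (\<Sum>b | (v, b) \<in> parcs G. f b)"
  have d2: "d \<ge> 2" using dv by (simp add: d_def)
  have opv: "alpha_op \<alpha> G f v = \<alpha> * d * y + \<beta> * T"
    by (simp add: alpha_op_eq_degree d_def T_def y_def \<beta>_def)
  \<comment> \<open>The second neighbour of v makes \<open>T > x\<close> strict.\<close>
  obtain w' where w': "(v, w') \<in> parcs G" "w' \<noteq> u" using other[OF dv] by blast
  have "f u + f w' \<le> T"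
    unfolding T_def using w' vu fin nb_pos
    by (intro sum_ge_two_terms) (auto intro: less_imp_le)
  then have Tx: "T > x" using nb_pos[OF w'(1)] by (simp add: x_def)
  have eqv: "\<alpha> * d * y + \<beta> * T + path_weight \<alpha> k q' * y = k * y"
    using eig[OF verts(2)] neq opv q by (simp add: y_def)
  have Sq: "S q > 0" "S (Suc q) > 0" "S (Suc (Suc q)) > 0" using S_pos pq q by auto
  \<comment> \<open>The weight cancels one \<open>\<alpha> * y\<close>. Since v has degree at least
    2 in \<open>G\<close>, another one remains and becomes the term with c.\<close>
  have TS: "T * S q \<le> y * (S (Suc q) - c * S q)"
  proof -
    have pw: "path_weight \<alpha> k q' = k - \<alpha> - \<beta> * S (Suc q) / S q"
      using path_weight_eq_succ[OF \<alpha>(2), of k q'] Sq q by (simp add: S_def \<beta>_def)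
    have "\<alpha> * d * y + \<beta> * T = k * y - path_weight \<alpha> k q' * y" using eqv by linarith
    then have "\<alpha> * d * y + \<beta> * T = (\<alpha> + \<beta> * S (Suc q) / S q) * y"
      unfolding pw by (simp add: algebra_simps)
    moreover have "\<alpha> * 2 * y \<le> \<alpha> * d * y"
      using d2 \<alpha> xy by (intro mult_right_mono mult_left_mono) auto
    ultimately have "\<beta> * T \<le> (\<beta> * S (Suc q) / S q - \<alpha>) * y" by (simp add: algebra_simps)
    also have "\<dots> = \<beta> * ((S (Suc q) / S q - c) * y)" using c by (simp add: algebra_simps)
    finally have "T \<le> (S (Suc q) / S q - c) * y" using \<beta> by simp
    then show ?thesis using Sq by (simp add: field_simps)
  qed
  \<comment> \<open>For q = 1 this is an equality: the virtual value \<open>S 0 = - c\<close>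
    supplies exactly the c that is subtracted.\<close>
  have "S (Suc q) - c * S q \<le> t * S q"
  proof (cases q')
    case 0
    then show ?thesis by (simp add: q S_seq)
  next
    case (Suc m)
    have "S q' > 0" using S_pos[of m] Suc pq q by simp
    moreover have "S (Suc q) = t * S q - S q'" by (simp add: q S_seq)
    moreover have "c * S q \<ge> 0" using c Sq by simp
    ultimately show ?thesis by linarith
  qed
  then have "y * (S (Suc q) - c * S q) \<le> y * (t * S q)" using xy by (intro mult_left_mono) auto
  then have "T * S q \<le> (t * y) * S q" using TS by (simp add: algebra_simps)
  then have ty: "x < t * y" using Tx Sq by simp

  obtain w where w: "(u, w) \<in> parcs G" "w \<noteq> v" using other[OF du] by blast
  have w_u: "(w, u) \<in> parcs G" using w pair_sym_arcs by (auto simp: symmetric_def sym_def)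
  have wv: "w \<in> pverts G" "w \<noteq> u" "f w > 0"
    using w in_arcsD2 no_loop nb_pos by auto
  \<comment> \<open>The equation at w, where no path is attached, with all neighbours but u
    dropped.\<close>
  have xw: "x \<le> (t + c) * f w"
  proof -
    have "\<alpha> * f w + \<beta> * f u \<le> alpha_op \<alpha> G f w"
      unfolding alpha_op_def \<beta>_def using fin nb_pos wv w_u \<alpha>
      by (intro member_le_sum[of u _ "\<lambda>b. \<alpha> * f w + (1 - \<alpha>) * f b"])
        (auto intro!: add_nonneg_nonneg mult_nonneg_nonneg simp: less_imp_le)
    also have "\<dots> = k * f w" using eig[OF wv(1)] wv w by simp
    finally have "\<beta> * x \<le> \<beta> * ((t + c) * f w)" using k c by (simp add: x_def algebra_simps)
    then show ?thesis using \<beta> by simp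
  qed
  \<comment> \<open>If t < 2 then f v > f u / 2, and another neighbour w of u gives c f u + f w \<ge> f u / 2.\<close>
  have grow: "t \<ge> 2 \<or> S (Suc (Suc p)) \<le> S (Suc (Suc (Suc p)))"
  proof (rule disjCI)
    assume "\<not> S (Suc (Suc p)) \<le> S (Suc (Suc (Suc p)))"
    show "t \<ge> 2"
    proof (rule ccontr)
      assume "\<not> t \<ge> 2"
      have Sp: "S (Suc (Suc p)) > 0" using S_pos by simp
      have pw: "path_weight \<alpha> k (Suc p) = k - \<alpha> - \<beta> * S (Suc (Suc (Suc p))) / S (Suc (Suc p))"
        using path_weight_eq_succ[OF \<alpha>(2), of k "Suc p"] Sp by (simp add: S_def \<beta>_def)
      \<comment> \<open>v and w bring one \<open>\<alpha> * f u\<close> each; the rewritten weight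
        absorbs one, and the other becomes \<open>c * x\<close>.\<close>
      have "(\<alpha> * f u + \<beta> * f v) + (\<alpha> * f u + \<beta> * f w) \<le> alpha_op \<alpha> G f u"
        unfolding alpha_op_def \<beta>_def using fin nb_pos uv w \<alpha> xy
        by (intro sum_ge_two_terms[of _ v w "\<lambda>b. \<alpha> * f u + (1 - \<alpha>) * f b"])
          (auto intro!: add_nonneg_nonneg mult_nonneg_nonneg simp: less_imp_le x_def)
      also have "\<dots> = k * x - path_weight \<alpha> k (Suc p) * x"
        using eig[OF verts(1)] neq by (simp add: x_def)
      also have "\<dots> = (\<alpha> + \<beta> * S (Suc (Suc (Suc p))) / S (Suc (Suc p))) * x"
        unfolding pw by (simp add: algebra_simps)
      finally have "\<beta> * (c * x + y + f w) \<le> \<beta> * (S (Suc (Suc (Suc p))) / S (Suc (Suc p)) * x)"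
        using c by (simp add: x_def y_def algebra_simps)
      then have 1: "c * x + y + f w \<le> S (Suc (Suc (Suc p))) / S (Suc (Suc p)) * x"
        by (simp only: mult_le_cancel_left_pos[OF \<beta>])
      have "S (Suc (Suc (Suc p))) / S (Suc (Suc p)) < 1"
        using Sp \<open>\<not> S (Suc (Suc p)) \<le> _\<close> by simp
      then have "S (Suc (Suc (Suc p))) / S (Suc (Suc p)) * x < 1 * x"
        using xy by (intro mult_strict_right_mono) auto
      then have 2: "c * x + y + f w < x" using 1 by simp
      have "t * y \<le> 2 * y" using \<open>\<not> t \<ge> 2\<close> xy by (intro mult_right_mono) auto
      then have y2: "x < 2 * y" using ty by simp
      have "(t + c) * f w \<le> (2 + c) * f w" using \<open>\<not> t \<ge> 2\<close> wv by (intro mult_right_mono) auto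
      then have w2: "x \<le> (2 + c) * f w" using xw by simp
      have "c * x + f w < x / 2" using 2 y2 by simp
      then have "(2 + c) * (c * x + f w) < (2 + c) * (x / 2)"
        using c by (intro mult_strict_left_mono) auto
      moreover have "c * (c * x) \<ge> 0" "c * x \<ge> 0" using c xy by auto
      ultimately show False using w2 by (simp add: algebra_simps)
    qed
  qed
  have S_mono: "S (Suc n) \<le> S (Suc (Suc n))" if "n < Suc p" for n
    using path_seq_mono[of c "Suc p" t n] that grow S_pos c(1) unfolding S_seq by blast
  have S_le: "S (Suc m) \<le> S (Suc n)" if "m \<le> n" "n \<le> Suc p" for m n
    using that
  proof (induction rule: dec_induct)
    case (step n)
    then show ?case using S_mono[of n] by simp
  qed simp
  define P where "P = S (Suc p) * S (Suc (Suc p))"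
  have P: "P > 0" using S_pos by (simp add: P_def)
  have PS: "S (Suc q) * S (Suc (Suc q)) \<le> P"
    unfolding P_def using S_le[of q p] S_le[of "Suc q" "Suc p"] pq Sq
    by (intro mult_mono) (auto simp: less_imp_le)

  \<comment> \<open>This b compensates exactly the loss of potential at u.\<close>
  define b where "b = K * x / P"
  have b: "b > 0" using K P xy by (simp add: b_def)
  define z where "z a = (if a = v then y + b else f a)" for a
  have zf: "f a \<le> z a" for a using b by (simp add: z_def y_def)
  have z_pos: "z a > 0" if "a \<in> pverts G" for a using f[OF that] zf[of a] by simp

  have opz: "alpha_op \<alpha> G z u + path_weight \<alpha> k p * z u = k * z u"
  proof -
    have "(\<Sum>a | (u, a) \<in> parcs G. z a) = (\<Sum>a | (u, a) \<in> parcs G. f a + (if a = v then b else 0))"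
      by (intro sum.cong) (auto simp: z_def y_def)
    also have "\<dots> = (\<Sum>a | (u, a) \<in> parcs G. f a) + b"
      using fin uv by (simp add: sum.distrib)
    finally have "alpha_op \<alpha> G z u = alpha_op \<alpha> G f u + \<beta> * b"
      using neq by (simp add: alpha_op_eq_degree z_def \<beta>_def algebra_simps)
    moreover have "(path_weight \<alpha> k (Suc p) - path_weight \<alpha> k p) * x = \<beta> * b"
      using path_weight_diff[of \<alpha> k p] S_pos[of p] S_pos[of "Suc p"] S_cas[of p]
      by (simp add: S_def \<beta>_def b_def P_def)
    moreover have "alpha_op \<alpha> G f u + path_weight \<alpha> k (Suc p) * x = k * x"
      using eig[OF verts(1)] neq by (simp add: x_def)
    ultimately show ?thesis using neq by (simp add: z_def x_def algebra_simps)
  qed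

  have opzv: "k * z v < alpha_op \<alpha> G z v + path_weight \<alpha> k q * z v"
  proof -
    define Q where "Q = S q * S (Suc q)"
    have Q: "Q > 0" using Sq by (simp add: Q_def)
    have "(\<Sum>a | (v, a) \<in> parcs G. z a) = T"
      unfolding T_def using no_loop[of v] by (intro sum.cong) (auto simp: z_def)
    then have opv': "alpha_op \<alpha> G z v = \<alpha> * d * (y + b) + \<beta> * T"
      by (simp add: alpha_op_eq_degree z_def d_def \<beta>_def)
    have diff: "path_weight \<alpha> k q = path_weight \<alpha> k q' + \<beta> * K / Q"
      using path_weight_diff[of \<alpha> k q'] Sq S_cas[of q'] q by (simp add: S_def \<beta>_def Q_def)
    \<comment> \<open>Substituting k from the old equation at v removes the degree term; the defect
      at v becomes \<open>\<beta> * (K * (y + b) / Q - T * b / y)\<close>.\<close>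
    have kv: "k = \<alpha> * d + path_weight \<alpha> k q' + \<beta> * T / y"
      using eqv xy by (simp add: field_simps)
    \<comment> \<open>With denominators cleared and \<open>b * P = K * x\<close>, the claim reads
      \<open>x * (T * Q) < y * y * P + K * x * y\<close>. The Casorati identity splits the bound on
      \<open>T * Q\<close> into two parts, one for each summand; the present inequality settles the
      first.\<close>
    have "x * S q * S (Suc (Suc q)) < y * P"
    proof -
      have "x * S q < T * S q" using Tx Sq by simp
      also have "\<dots> \<le> y * (S (Suc q) - c * S q)" by (rule TS)
      also have "\<dots> \<le> y * S (Suc q)" using c Sq xy by (intro mult_left_mono) auto
      finally have "x * S q * S (Suc (Suc q)) < y * S (Suc q) * S (Suc (Suc q))"
        using Sq by (intro mult_strict_right_mono)
      also have "\<dots> \<le> y * P" using PS xy by simp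
      finally show ?thesis .
    qed
    then have "x * y * (S q * S (Suc (Suc q))) < y * y * P"
      using xy mult_strict_left_mono[of "x * S q * S (Suc (Suc q))" "y * P" y]
      by (simp add: algebra_simps)
    moreover have "x * (T * Q) \<le> x * y * (S q * S (Suc (Suc q)) + K)"
    proof -
      have "T * Q \<le> y * (S (Suc q) - c * S q) * S (Suc q)"
        using mult_right_mono[OF TS, of "S (Suc q)"] Sq by (simp add: Q_def algebra_simps)
      also have "\<dots> \<le> y * S (Suc q) * S (Suc q)"
        using c Sq xy by (intro mult_left_mono mult_right_mono) auto
      also have "\<dots> = y * (S q * S (Suc (Suc q)) + K)"
        using S_cas[of q] by (simp add: power2_eq_square)
      finally show ?thesis using xy by (simp add: mult_left_mono mult.assoc)
    qed
    ultimately have "x * (T * Q) < y * y * P + K * x * y" by (simp add: algebra_simps)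
    then have "T * (K * x) * Q < K * ((y * P + K * x) * y)"
      using mult_strict_left_mono[of "x * (T * Q)" "y * y * P + K * x * y" K] K
      by (simp add: algebra_simps)
    moreover have bP: "K * x = b * P" using P by (simp add: b_def)
    ultimately have "(T * b * Q) * P < (K * (y + b) * y) * P" by (simp add: algebra_simps)
    then have "T * b * Q < K * (y + b) * y" using P by simp
    then have "T * b / y < K * (y + b) / Q" using Q xy by (simp add: field_simps)
    then have "\<beta> * (T * b / y) < \<beta> * (K * (y + b) / Q)"
      using \<beta> by (rule mult_strict_left_mono)
    moreover have "alpha_op \<alpha> G z v + path_weight \<alpha> k q * z v - k * z v
        = \<beta> * (K * (y + b) / Q) - \<beta> * (T * b / y)"
    proof -
      have "alpha_op \<alpha> G z v + path_weight \<alpha> k q * z v - k * z v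
        = \<beta> * T + \<beta> * K / Q * (y + b) - \<beta> * T / y * (y + b)"
        unfolding opv' diff by (subst kv) (simp add: z_def algebra_simps)
      also have "\<dots> = \<beta> * (K * (y + b) / Q) - \<beta> * (T * b / y)"
        using xy Q by (simp add: field_simps)
      finally show ?thesis .
    qed
    ultimately show ?thesis by linarith
  qed

  show ?thesis
  proof (rule that[of z])
    fix a assume a: "a \<in> pverts G"
    show "k * z a \<le> alpha_op \<alpha> G z a +
      (if a = u then path_weight \<alpha> k p * z a else 0) +
      (if a = v then path_weight \<alpha> k q * z a else 0)"
    proof (cases "a = u \<or> a = v")
      case True
      then show ?thesis using opz opzv neq by auto
    next
      case False
      then have "alpha_op \<alpha> G f a = k * z a" using eig[OF a] by (simp add: z_def)
      moreover have "alpha_op \<alpha> G f a \<le> alpha_op \<alpha> G z a"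
        using \<alpha> zf by (intro alpha_op_mono) auto
      ultimately show ?thesis using False by simp
    qed
  qed (use z_pos opzv in auto)
qed

section \<open>Eliminating pendant paths\<close>

text \<open>Counting u as vertex 0 gives every path vertex a predecessor, the first one
  included.\<close>

definition path_vertex :: "'a \<Rightarrow> nat \<Rightarrow> 'a + nat" where
  "path_vertex u i = (if i = 0 then Inl u else Inr i)"

lemma pverts_attach_path: "pverts (attach_path G u p) = Inl ` pverts G \<union> Inr ` {1..p}"
  by (simp add: attach_path_def)

lemma attach_path_nbrs_Inl:
  "{b. (Inl a, b) \<in> parcs (attach_path G u p)} =
    Inl ` {b. (a, b) \<in> parcs G} \<union> (if a = u \<and> 1 \<le> p then {Inr 1} else {})"
  by (force simp: attach_path_def symcl_def)

lemma attach_path_nbrs_Inr: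
  assumes "1 \<le> i" "i \<le> p"
  shows "{b. (Inr i, b) \<in> parcs (attach_path G u p)} =
    insert (path_vertex u (i - 1)) (if i < p then {Inr (Suc i)} else {})"
proof (rule Set.set_eqI)
  fix b
  show "b \<in> {b. (Inr i, b) \<in> parcs (attach_path G u p)} \<longleftrightarrow>
    b \<in> insert (path_vertex u (i - 1)) (if i < p then {Inr (Suc i)} else {})"
    using assms by (cases b) (auto simp: attach_path_def symcl_def path_vertex_def)
qed

lemma alpha_op_attach_path_Inl:
  assumes "pair_graph G"
  shows "alpha_op \<alpha> (attach_path G u p) F (Inl a) = alpha_op \<alpha> G (F \<circ> Inl) a +
    (if a = u \<and> 1 \<le> p then \<alpha> * F (Inl u) + (1 - \<alpha>) * F (Inr 1) else 0)"
proof -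
  have "alpha_op \<alpha> (attach_path G u p) F (Inl a) =
      (\<Sum>b\<in>Inl ` {b. (a, b) \<in> parcs G}. \<alpha> * F (Inl a) + (1 - \<alpha>) * F b) +
      (\<Sum>b\<in>(if a = u \<and> 1 \<le> p then {Inr 1} else {}). \<alpha> * F (Inl a) + (1 - \<alpha>) * F b)"
    unfolding alpha_op_def attach_path_nbrs_Inl
    using pair_graph_finite_nbrs[OF assms] by (intro sum.union_disjoint) auto
  also have "(\<Sum>b\<in>Inl ` {b. (a, b) \<in> parcs G}. \<alpha> * F (Inl a) + (1 - \<alpha>) * F b)
      = alpha_op \<alpha> G (F \<circ> Inl) a"
    by (subst sum.reindex) (auto simp: alpha_op_def)
  finally show ?thesis by simp
qed

lemma alpha_op_attach_path_Inr:
  assumes "1 \<le> i" "i \<le> p"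
  shows "alpha_op \<alpha> (attach_path G u p) F (Inr i) =
    \<alpha> * F (Inr i) + (1 - \<alpha>) * F (path_vertex u (i - 1)) +
    (if i < p then \<alpha> * F (Inr i) + (1 - \<alpha>) * F (Inr (Suc i)) else 0)"
  unfolding alpha_op_def attach_path_nbrs_Inr[OF assms]
  using assms by (auto simp: path_vertex_def)

text \<open>A nonempty closed set that meets the path walks down to u, hence it meets and then
  contains the copy of \<open>G\<close>, and from u it walks up the whole path.\<close>

lemma connected_attach_path:
  assumes G: "pair_graph G" "Digraph_Component.connected (with_proj G)" and u: "u \<in> pverts G"
  shows "Digraph_Component.connected (with_proj (attach_path G u p))"
  unfolding connected_iff_no_closed_subset[OF pair_graph_attach_path[OF G(1) u]]
proof (intro conjI allI impI)
  let ?H = "attach_path G u p"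
  note conn = G(2)[unfolded connected_iff_no_closed_subset[OF G(1)]]
  show "pverts ?H \<noteq> {}" using u by (auto simp: pverts_attach_path)
  fix Z assume Z: "Z \<subseteq> pverts ?H" "Z \<noteq> {}" "\<forall>a b. a \<in> Z \<longrightarrow> (a, b) \<in> parcs ?H \<longrightarrow> b \<in> Z"
  have down: "Inl u \<in> Z" if "path_vertex u i \<in> Z" "i \<le> p" for i
    using that
  proof (induction i)
    case (Suc i)
    then have "path_vertex u i \<in> {b. (Inr (Suc i), b) \<in> parcs ?H}"
      by (subst attach_path_nbrs_Inr) auto
    then show ?case using Suc Z(3) by (auto simp: path_vertex_def)
  qed (simp add: path_vertex_def)
  have "\<exists>a. Inl a \<in> Z"
  proof -
    obtain b where b: "b \<in> Z" using Z(2) by blast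
    then have "b \<in> pverts ?H" using Z(1) by blast
    then consider a where "b = Inl a" | i where "b = Inr i" "1 \<le> i" "i \<le> p"
      by (auto simp: pverts_attach_path)
    then show ?thesis
    proof cases
      case (2 i)
      then show ?thesis using b down[of i] by (auto simp: path_vertex_def)
    qed (use b in auto)
  qed
  moreover have "b \<in> Inl -` Z" if "a \<in> Inl -` Z" "(a, b) \<in> parcs G" for a b
  proof -
    have "Inl b \<in> {b. (Inl a, b) \<in> parcs ?H}"
      using that(2) by (subst attach_path_nbrs_Inl) auto
    then show ?thesis using that Z(3) by auto
  qed
  moreover have "Inl -` Z \<subseteq> pverts G" using Z(1) by (auto simp: pverts_attach_path)
  ultimately have "Inl -` Z = pverts G" using conn by (metis vimageI empty_iff)
  then have inl: "Inl ` pverts G \<subseteq> Z" by blast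
  have up: "path_vertex u i \<in> Z" if "i \<le> p" for i
    using that
  proof (induction i)
    case 0
    then show ?case using inl u by (auto simp: path_vertex_def)
  next
    case (Suc i)
    have "(path_vertex u i, Inr (Suc i)) \<in> parcs ?H"
      using Suc.prems by (auto simp: path_vertex_def attach_path_def symcl_def)
    then show ?case using Suc Z(3) by (auto simp: path_vertex_def)
  qed
  have "Inr i \<in> Z" if "i \<in> {1..p}" for i
    using up[of i] that by (simp add: path_vertex_def)
  then show "Z = pverts ?H" using Z(1) inl by (auto simp: pverts_attach_path)
qed

text \<open>The equations are solved from the free end towards u, so j is the distance from that
  end, and the value there is the only free parameter.\<close>

lemma pendant_path_values:
  assumes \<alpha>: "\<alpha> < 1"
    and eig: "\<And>i. 1 \<le> i \<Longrightarrow> i \<le> p \<Longrightarrow> alpha_op \<alpha> (attach_path G u p) F (Inr i) = k * F (Inr i)"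
    and j: "j \<le> p"
  shows "F (path_vertex u (p - j)) = F (path_vertex u p) * alpha_path_seq \<alpha> k (Suc j)"
  using j
proof (induction j rule: less_induct)
  case (less j)
  let ?S = "alpha_path_seq \<alpha> k" and ?E = "F (path_vertex u p)"
  note rec = alpha_path_seq_recurrence[OF \<alpha>, of k]
  show ?case
  proof (cases j)
    case 0
    then show ?thesis by (simp add: rec(2))
  next
    case (Suc m)
    define i where "i = p - m"
    have i: "1 \<le> i" "i \<le> p" "p - j = i - 1" using Suc less.prems by (auto simp: i_def)
    have Fi: "F (Inr i) = ?E * ?S (Suc m)"
      using less.IH[of m] Suc less.prems i(1) by (simp add: i_def path_vertex_def)
    \<comment> \<open>The forward neighbour together with its share of the degree. At the free end
      both are missing, and the virtual value at index 0 makes the right side vanish.\<close>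
    have next_val: "(if i < p then \<alpha> * F (Inr i) + (1 - \<alpha>) * F (Inr (Suc i)) else 0) =
        ?E * (\<alpha> * ?S (Suc m) + (1 - \<alpha>) * ?S m)"
    proof (cases m)
      case 0
      then show ?thesis using rec(1) by (simp add: i_def)
    next
      case (Suc l)
      have "path_vertex u (p - l) = Inr (Suc i)"
        using Suc \<open>j = Suc m\<close> less.prems by (auto simp: i_def path_vertex_def)
      then have "F (Inr (Suc i)) = ?E * ?S m"
        using less.IH[of l] Suc \<open>j = Suc m\<close> less.prems by simp
      then show ?thesis using Suc \<open>j = Suc m\<close> less.prems Fi by (simp add: i_def algebra_simps)
    qed
    have "\<alpha> * F (Inr i) + (1 - \<alpha>) * F (path_vertex u (i - 1)) +
        ?E * (\<alpha> * ?S (Suc m) + (1 - \<alpha>) * ?S m) = k * F (Inr i)"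
      using eig[OF i(1,2)] alpha_op_attach_path_Inr[OF i(1,2), of \<alpha> G u F] next_val by simp
    then have "(1 - \<alpha>) * F (path_vertex u (i - 1)) =
        ?E * (k * ?S (Suc m) - 2 * \<alpha> * ?S (Suc m) - (1 - \<alpha>) * ?S m)"
      unfolding Fi by (simp add: algebra_simps)
    also have "k * ?S (Suc m) - 2 * \<alpha> * ?S (Suc m) - (1 - \<alpha>) * ?S m = (1 - \<alpha>) * ?S (Suc (Suc m))"
      using rec(3)[of m] by (simp add: algebra_simps)
    finally have "(1 - \<alpha>) * F (path_vertex u (i - 1)) = (1 - \<alpha>) * (?E * ?S (Suc (Suc m)))"
      by (simp add: algebra_simps)
    then show ?thesis using \<alpha> i(3) Suc by simp
  qed
qed

text \<open>Positivity of S comes from the vector: its positive values on the path are positive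
  multiples of terms of S.\<close>

lemma pendant_path_elimination:
  assumes G: "pair_graph G" and \<alpha>: "\<alpha> < 1"
    and eig: "\<And>i. 1 \<le> i \<Longrightarrow> i \<le> p \<Longrightarrow> alpha_op \<alpha> (attach_path G u p) F (Inr i) = k * F (Inr i)"
    and pos: "\<And>i. i \<le> p \<Longrightarrow> F (path_vertex u i) > 0"
  shows "j \<le> p \<Longrightarrow> alpha_path_seq \<alpha> k (Suc j) > 0"
    and "alpha_op \<alpha> (attach_path G u p) F (Inl a) = alpha_op \<alpha> G (F \<circ> Inl) a +
      (if a = u then path_weight \<alpha> k p * F (Inl a) else 0)"
proof -
  let ?S = "alpha_path_seq \<alpha> k" and ?E = "F (path_vertex u p)"
  note val = pendant_path_values[OF \<alpha> eig]
  show S: "?S (Suc j) > 0" if "j \<le> p" for j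
  proof -
    have "?E * ?S (Suc j) > 0" using val[OF _ _ that] pos[of "p - j"] by simp
    then show ?thesis using pos[of p] by (simp add: zero_less_mult_iff)
  qed
  have Fu: "F (Inl u) = ?E * ?S (Suc p)"
    using val[of p] by (simp add: path_vertex_def)
  have "path_weight \<alpha> k p * F (Inl u) = ?E * (\<alpha> * ?S (Suc p) + (1 - \<alpha>) * ?S p)"
    unfolding Fu path_weight_def using S[of p] by (simp add: field_simps)
  also have "\<dots> = (if 1 \<le> p then \<alpha> * F (Inl u) + (1 - \<alpha>) * F (Inr 1) else 0)"
  proof (cases p)
    case 0
    then show ?thesis using alpha_path_seq_recurrence(1)[OF \<alpha>, of k] by simp
  next
    case (Suc m)
    then have "F (Inr 1) = ?E * ?S p" using val[of m] by (simp add: path_vertex_def)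
    then show ?thesis unfolding Fu using Suc by (simp add: algebra_simps)
  qed
  finally show "alpha_op \<alpha> (attach_path G u p) F (Inl a) = alpha_op \<alpha> G (F \<circ> Inl) a +
      (if a = u then path_weight \<alpha> k p * F (Inl a) else 0)"
    unfolding alpha_op_attach_path_Inl[OF G] by auto
qed

section \<open>Prolonging a vector from \<open>G\<close> along a pendant path\<close>

definition path_extension :: "(nat \<Rightarrow> real) \<Rightarrow> 'a \<Rightarrow> nat \<Rightarrow> ('a \<Rightarrow> real) \<Rightarrow> 'a + nat \<Rightarrow> real" where
  "path_extension S u p f = case_sum f (\<lambda>i. f u * S (Suc p - i) / S (Suc p))"

lemma path_extension_path_vertex:
  assumes "S (Suc p) \<noteq> 0"
  shows "path_extension S u p f (path_vertex u i) = f u / S (Suc p) * S (Suc p - i)"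
  using assms by (simp add: path_extension_def path_vertex_def)

text \<open>The path equations hold exactly for every f, so a subsolution has to be checked only on
  the vertices of \<open>G\<close>.\<close>

lemma path_extension_eigen:
  fixes u :: 'a and f :: "'a \<Rightarrow> real"
  assumes \<alpha>: "\<alpha> < 1" and S: "alpha_path_seq \<alpha> k (Suc p) \<noteq> 0" and i: "1 \<le> i" "i \<le> p"
  defines F_def: "F \<equiv> path_extension (alpha_path_seq \<alpha> k) u p f"
  shows "alpha_op \<alpha> (attach_path G u p) F (Inr i) = k * F (Inr i)"
proof -
  let ?S = "alpha_path_seq \<alpha> k"
  define e where "e = f u / ?S (Suc p)"
  have F: "F (path_vertex u j) = e * ?S (Suc p - j)" for j
    using path_extension_path_vertex[of ?S p u f j] S by (simp add: F_def e_def)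
  define m where "m = p - i"
  have Fi: "F (Inr i) = e * ?S (Suc m)" and Fp: "F (path_vertex u (i - 1)) = e * ?S (Suc (Suc m))"
    using F[of i] F[of "i - 1"] i by (auto simp: path_vertex_def m_def Suc_diff_le)
  have next_val: "(if i < p then \<alpha> * F (Inr i) + (1 - \<alpha>) * F (Inr (Suc i)) else 0) =
      e * (\<alpha> * ?S (Suc m) + (1 - \<alpha>) * ?S m)"
  proof (cases "i < p")
    case True
    then have "F (Inr (Suc i)) = e * ?S m" using F[of "Suc i"] by (simp add: path_vertex_def m_def)
    then show ?thesis using True Fi by (simp add: algebra_simps)
  next
    case False
    then show ?thesis using alpha_path_seq_recurrence(1)[OF \<alpha>, of k] i by (simp add: m_def)
  qed
  have "alpha_op \<alpha> (attach_path G u p) F (Inr i) =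
      e * (2 * \<alpha> * ?S (Suc m) + (1 - \<alpha>) * (?S m + ?S (Suc (Suc m))))"
    unfolding alpha_op_attach_path_Inr[OF i] next_val unfolding Fi Fp by (simp add: algebra_simps)
  then show ?thesis unfolding alpha_path_seq_recurrence(3)[OF \<alpha>] Fi by simp
qed

lemma path_extension_pos:
  assumes "\<And>j. j \<le> p \<Longrightarrow> S (Suc j) > 0" and "\<And>a. a \<in> pverts G \<Longrightarrow> f a > 0" and "u \<in> pverts G"
    and "w \<in> pverts (attach_path G u p)"
  shows "path_extension S u p f w > 0"
proof (cases w)
  case (Inl a)
  then show ?thesis using assms by (auto simp: path_extension_def pverts_attach_path)
next
  case (Inr i)
  then have "i \<ge> 1" "i \<le> p" using assms(4) by (auto simp: pverts_attach_path)
  then have "S (Suc p - i) > 0" using assms(1)[of "p - i"] by (simp add: Suc_diff_le)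
  then show ?thesis using Inr assms(1)[of p] assms(2,3) by (simp add: path_extension_def)
qed

lemma path_vertex_in_verts:
  assumes "u \<in> pverts G" "i \<le> p"
  shows "path_vertex u i \<in> pverts (attach_path G u p)"
  using assms by (auto simp: path_vertex_def pverts_attach_path)

text \<open>The prolonged vector is positive and solves the path equations, so the elimination can
  be read backwards.\<close>

lemma alpha_op_path_extension_Inl:
  assumes G: "pair_graph G" "u \<in> pverts G" and \<alpha>: "\<alpha> < 1"
    and S: "\<And>j. j \<le> p \<Longrightarrow> alpha_path_seq \<alpha> k (Suc j) > 0"
    and f: "\<And>a. a \<in> pverts G \<Longrightarrow> f a > 0"
  shows "alpha_op \<alpha> (attach_path G u p) (path_extension (alpha_path_seq \<alpha> k) u p f) (Inl a) =
    alpha_op \<alpha> G f a + (if a = u then path_weight \<alpha> k p * f a else 0)"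
proof -
  let ?F = "path_extension (alpha_path_seq \<alpha> k) u p f"
  have "?F (path_vertex u i) > 0" if "i \<le> p" for i
    using S f G(2) path_vertex_in_verts[OF G(2) that] by (rule path_extension_pos)
  then have "alpha_op \<alpha> (attach_path G u p) ?F (Inl a) = alpha_op \<alpha> G (?F \<circ> Inl) a +
      (if a = u then path_weight \<alpha> k p * ?F (Inl a) else 0)"
    using path_extension_eigen[OF \<alpha>, of k p] S[of p]
    by (intro pendant_path_elimination(2)[OF G(1) \<alpha>]) auto
  then show ?thesis by (simp add: path_extension_def comp_def)
qed

section \<open>Comparison of the two graphs\<close>

theorem theorem3p6:
  fixes G :: "'a pair_pre_digraph" and u v :: 'a and p q :: nat and \<alpha> :: real
  assumes "pair_graph G" and "Digraph_Component.connected (with_proj G)"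
    and "u \<in> pverts G" and "v \<in> pverts G" and "(u, v) \<in> parcs G"
    and "out_degree (with_proj G) u \<ge> 2" and "out_degree (with_proj G) v \<ge> 2"
    and "p \<ge> q" and "q \<ge> 1"
    and "0 \<le> \<alpha>" and "\<alpha> < 1"
  shows "alpha_index \<alpha> (attach_two_paths G u v p q) >
         alpha_index \<alpha> (attach_two_paths G u v (p + 1) (q - 1))"
proof -
  note G = assms(1,2) and \<alpha> = assms(10,11)
  have two_paths: "pair_graph (attach_path G u r)" "Inl v \<in> pverts (attach_path G u r)"
    "pair_graph (attach_two_paths G u v r s)"
    "Digraph_Component.connected (with_proj (attach_two_paths G u v r s))" for r s
  proof -
    show 1: "pair_graph (attach_path G u r)" using assms by (intro pair_graph_attach_path)
    show 2: "Inl v \<in> pverts (attach_path G u r)" using assms by (simp add: pverts_attach_path)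
    show "pair_graph (attach_two_paths G u v r s)"
      unfolding attach_two_paths_def by (intro pair_graph_attach_path 1 2)
    show "Digraph_Component.connected (with_proj (attach_two_paths G u v r s))"
      unfolding attach_two_paths_def by (intro connected_attach_path 1 2 assms)
  qed
  let ?H = "attach_path G u (p + 1)" and ?H' = "attach_path G u p"
  let ?G = "attach_two_paths G u v (p + 1) (q - 1)" and ?G' = "attach_two_paths G u v p q"
  define k where "k = alpha_index \<alpha> ?G"
  let ?S = "alpha_path_seq \<alpha> k"
  obtain F where F: "\<And>a. a \<in> pverts ?G \<Longrightarrow> F a > 0"
    and eig: "\<And>a. a \<in> pverts ?G \<Longrightarrow> alpha_op \<alpha> ?G F a = k * F a"
    using alpha_index_perron_vector[OF two_paths(3,4) \<alpha>, of "p + 1" "q - 1"]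
    unfolding k_def by blast
  have Inl_verts: "Inl a \<in> pverts ?G" if "a \<in> pverts ?H" for a
    using that unfolding attach_two_paths_def pverts_attach_path[of ?H] by blast
  define h where "h = F \<circ> Inl"
  \<comment> \<open>The path at v was attached last and is removed first. Its potential sits only at
    \<open>Inl v\<close>, so the equations on the path at u are untouched and that path can be
    removed next.\<close>
  have elim_v: "alpha_op \<alpha> ?G F (Inl a) = alpha_op \<alpha> ?H h a +
      (if a = Inl v then path_weight \<alpha> k (q - 1) * F (Inl a) else 0)" for a
    unfolding attach_two_paths_def h_def
  proof (rule pendant_path_elimination(2)[OF two_paths(1) \<alpha>(2)])
    show "alpha_op \<alpha> (attach_path ?H (Inl v) (q - 1)) F (Inr i) = k * F (Inr i)"
      if "1 \<le> i" "i \<le> q - 1" for i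
      using eig[of "Inr i"] that unfolding attach_two_paths_def pverts_attach_path by auto
    show "F (path_vertex (Inl v) i) > 0" if "i \<le> q - 1" for i
      using F path_vertex_in_verts[OF two_paths(2) that] unfolding attach_two_paths_def by blast
  qed
  have h_pos: "h a > 0" if "a \<in> pverts ?H" for a
    using F[OF Inl_verts[OF that]] by (simp add: h_def)
  have h_eig: "alpha_op \<alpha> ?H h a +
      (if a = Inl v then path_weight \<alpha> k (q - 1) * h a else 0) = k * h a" if "a \<in> pverts ?H" for a
    using eig[OF Inl_verts[OF that]] elim_v[of a] by (simp add: h_def)
  define f where "f = h \<circ> Inl"
  have eigr: "alpha_op \<alpha> ?H h (Inr i) = k * h (Inr i)" if "1 \<le> i" "i \<le> p + 1" for i
    using h_eig[of "Inr i"] that by (auto simp: pverts_attach_path)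
  have posr: "h (path_vertex u i) > 0" if "i \<le> p + 1" for i
    by (rule h_pos) (rule path_vertex_in_verts[OF assms(3) that])
  have elim_u: "alpha_op \<alpha> ?H h (Inl a) = alpha_op \<alpha> G (h \<circ> Inl) a +
      (if a = u then path_weight \<alpha> k (p + 1) * h (Inl a) else 0)" for a
    using G(1) \<alpha>(2) eigr posr by (rule pendant_path_elimination(2))
  have S: "?S (Suc j) > 0" if "j \<le> Suc p" for j
    using G(1) \<alpha>(2) eigr posr that[unfolded Suc_eq_plus1] by (rule pendant_path_elimination(1))
  have f_pos: "f a > 0" if "a \<in> pverts G" for a
    using h_pos[of "Inl a"] that by (simp add: f_def pverts_attach_path)
  have f_eig: "alpha_op \<alpha> G f a + (if a = u then path_weight \<alpha> k (p + 1) * f a else 0) +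
      (if a = v then path_weight \<alpha> k (q - 1) * f a else 0) = k * f a" if "a \<in> pverts G" for a
  proof -
    have "Inl a \<in> pverts ?H" using that by (simp add: pverts_attach_path)
    from h_eig[OF this] show ?thesis unfolding elim_u by (simp only: f_def comp_apply sum.inject)
  qed
  obtain z where z: "\<And>a. a \<in> pverts G \<Longrightarrow> z a > 0"
    and sub: "\<And>a. a \<in> pverts G \<Longrightarrow> k * z a \<le> alpha_op \<alpha> G z a +
      (if a = u then path_weight \<alpha> k p * z a else 0) +
      (if a = v then path_weight \<alpha> k q * z a else 0)"
    and strict: "k * z v < alpha_op \<alpha> G z v + path_weight \<alpha> k q * z v"
    using shifted_subsolution[OF G(1) assms(5-9) \<alpha> S f_pos f_eig[folded Suc_eq_plus1]] by blast
  have neq: "u \<noteq> v"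
  proof -
    interpret pair_graph G by (fact G)
    show ?thesis using assms(5) pair_no_loops by fastforce
  qed
  have Sp: "?S (Suc j) > 0" if "j \<le> p" for j using S that by simp
  \<comment> \<open>The path at v had only q - 1 vertices under the Perron vector; positivity up to
    length q comes from the path at u, since q \<le> p.\<close>
  have Sq: "?S (Suc j) > 0" if "j \<le> q" for j using S that assms(8) by simp
  define y where "y = path_extension ?S u p z"
  define x where "x = path_extension ?S (Inl v) q y"
  have y_pos: "y a > 0" if "a \<in> pverts ?H'" for a
    unfolding y_def using Sp z assms(3) that by (rule path_extension_pos)
  have x_pos: "x a > 0" if "a \<in> pverts ?G'" for a
    unfolding x_def using Sq y_pos two_paths(2) that[unfolded attach_two_paths_def]
    by (rule path_extension_pos)
  have opx: "alpha_op \<alpha> ?G' x (Inl a) = alpha_op \<alpha> ?H' y a +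
      (if a = Inl v then path_weight \<alpha> k q * y a else 0)" for a
    unfolding x_def attach_two_paths_def
    using two_paths(1,2) \<alpha>(2) Sq y_pos by (rule alpha_op_path_extension_Inl)
  have opy: "alpha_op \<alpha> ?H' y (Inl a) = alpha_op \<alpha> G z a +
      (if a = u then path_weight \<alpha> k p * z a else 0)" for a
    unfolding y_def using G(1) assms(3) \<alpha>(2) Sp z by (rule alpha_op_path_extension_Inl)
  have xy: "x (Inl a) = y a" and yz: "y (Inl b) = z b" for a b
    by (simp_all add: x_def y_def path_extension_def)
  have "k < alpha_index \<alpha> ?G'"
  proof (rule alpha_index_gt_of_subsolution[OF two_paths(3,4) \<alpha>])
    show "x a > 0" if "a \<in> pverts ?G'" for a using that by (rule x_pos)
    show "Inl (Inl v) \<in> pverts ?G'"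
      using assms(4) by (simp add: attach_two_paths_def pverts_attach_path)
    show "k * x (Inl (Inl v)) < alpha_op \<alpha> ?G' x (Inl (Inl v))"
      using strict neq by (simp add: opx opy xy yz)
    fix a assume "a \<in> pverts ?G'"
    then consider (old) b where "a = Inl (Inl b)" "b \<in> pverts G"
      | (left) i where "a = Inl (Inr i)" "1 \<le> i" "i \<le> p"
      | (right) i where "a = Inr i" "1 \<le> i" "i \<le> q"
      by (auto simp: attach_two_paths_def pverts_attach_path)
    then show "k * x a \<le> alpha_op \<alpha> ?G' x a"
    proof cases
      case old
      show ?thesis
        using sub[OF old(2)] unfolding old(1) by (simp only: opx opy xy yz sum.inject)
    next
      case left
      have "alpha_op \<alpha> ?H' y (Inr i) = k * y (Inr i)"
        unfolding y_def using Sp[of p] left by (intro path_extension_eigen[OF \<alpha>(2)]) auto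
      then show ?thesis using left by (simp add: opx xy)
    next
      case right
      have "alpha_op \<alpha> ?G' x (Inr i) = k * x (Inr i)"
        unfolding x_def attach_two_paths_def
        using Sq[of q] right by (intro path_extension_eigen[OF \<alpha>(2)]) auto
      then show ?thesis using right by simp
    qed
  qed
  then show ?thesis by (simp add: k_def)
qed

end
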